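(* Let $0\le a<b$ and let $f:[a,b]\to\mathbb{R}$ be a convex function on $[a,b]$. Then for any $x\in(a,b)$ and any $\alpha\ge1$, $$\frac{1}{\alpha(\alpha+1)}\left[\alpha\frac{(b-x)^2}{b-a}f_+'(x)-\left((b-a)^{\alpha}(b-x)^{1-\alpha}+\alpha\frac{(b-x)^2}{b-a}-(\alpha+1)(b-x)\right)f_-'(x)\right]$$ $$\le \frac{\Gamma(\alpha)}{b-a}(b-x)^{1-\alpha}J_a^{\alpha}f(b)-J_a^{\alpha-1}\big(P_2(x,b)f(b)\big)-f(x),$$ where $$P_2(x,t)=\begin{cases}\dfrac{t-a}{b-a}(b-x)^{1-\alpha}\,\Gamma(\alpha), & a\le t<x,\\[2mm] \dfrac{t-b}{b-a}(b-x)^{1-\alpha}\,\Gamma(\alpha), & x\le t\le b.\end{cases}$$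
   Context: $f_+'(x)$ and $f_-'(x)$ are the right and left derivatives of $f$ at $x$. For $\beta\ge 0$ and $a\ge0$ the Riemann-Liouville fractional integral is $J_a^{\beta}g(y)=\frac{1}{\Gamma(\beta)}\int_a^y (y-t)^{\beta-1}g(t)\,dt$ if $\beta>0$, and $J_a^0g(y)=g(y)$. The notation $J_a^{\beta}(P_2(x,b)g(b))$ means $J_a^\beta$ applied to the function $t\mapsto P_2(x,t)g(t)$ and evaluated at $b$ (with $x$ fixed): for $\beta>0$ it equals $\frac{1}{\Gamma(\beta)}\int_a^b (b-t)^{\beta-1}P_2(x,t)g(t)\,dt$, and for $\beta=0$ it equals $P_2(x,b)g(b)$ (which is $0$ since $P_2(x,b)=0$). *)

theory Defs
  imports "HOL-Analysis.Analysis"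
begin

definition right_deriv :: "(real \<Rightarrow> real) \<Rightarrow> real \<Rightarrow> real" where
  "right_deriv f x = (THE D. (f has_real_derivative D) (at_right x))"

definition left_deriv :: "(real \<Rightarrow> real) \<Rightarrow> real \<Rightarrow> real" where
  "left_deriv f x = (THE D. (f has_real_derivative D) (at_left x))"

text \<open>
  The Riemann-Liouville fractional integral of order \<open>\<beta> \<ge> 0\<close> with base point \<open>a\<close>.
  The integrand is irrelevant at the single point \<open>t = y\<close>, where \<open>0 powr s = 0\<close> in HOL.
\<close>

definition rl_integral :: "real \<Rightarrow> real \<Rightarrow> (real \<Rightarrow> real) \<Rightarrow> real \<Rightarrow> real" where
  "rl_integral a \<beta> g y =
     (if \<beta> = 0 then g y
      else 1 / Gamma \<beta> * integral {a..y} (\<lambda>t. (y - t) powr (\<beta> - 1) * g t))"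

definition P2 :: "real \<Rightarrow> real \<Rightarrow> real \<Rightarrow> real \<Rightarrow> real \<Rightarrow> real" where
  "P2 a b \<alpha> x t =
     (if t < x then (t - a) / (b - a) * (b - x) powr (1 - \<alpha>) * Gamma \<alpha>
      else (t - b) / (b - a) * (b - x) powr (1 - \<alpha>) * Gamma \<alpha>)"

end

theory Submission
  imports Defs
begin

text \<open>
  Write \<open>c = (b - x) powr (1 - \<alpha>)\<close>. Substituting the two branches of the kernel \<open>P2\<close> and using
  \<open>Gamma \<alpha> = (\<alpha> - 1) * Gamma (\<alpha> - 1)\<close> for \<open>\<alpha> > 1\<close>, the difference of the two fractional integrals becomes a
  single weighted integral of \<open>f\<close> over \<open>[a, b]\<close>, namely \<open>c / (b - a)\<close> times

  \<^item> the integral over \<open>[x, b]\<close> of \<open>\<alpha> * (b - t) powr (\<alpha> - 1) * f t\<close>, plus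
  \<^item> the integral over \<open>[a, x]\<close> of \<open>K' t * f t\<close>, where \<open>K t = (t - a) * (b - t) powr (\<alpha> - 1)\<close>

  (lemma \<open>rl_integral_difference_eq\<close>). If \<open>f\<close> is replaced on each side of \<open>x\<close> by its one-sided
  tangent at \<open>x\<close>, these integrals are elementary and the whole expression becomes exactly \<open>f x\<close> plus
  the left-hand side of the inequality. So it remains to see that passing from \<open>f\<close> to the tangents does not increase
  either integral.

  On \<open>[x, b]\<close> the weight is nonnegative and \<open>f\<close> lies above its right tangent
  (\<open>integral_right_of_support\<close>). On \<open>[a, x]\<close> the weight \<open>K'\<close> may become negative near \<open>x\<close>, so that lying
  above the tangent is not enough. But the gap \<open>g\<close> between \<open>f\<close> and its left tangent is not only
  nonnegative, it also decreases towards \<open>x\<close>, while \<open>K'\<close> changes sign at most once, from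
  nonnegative to nonpositive, at some point \<open>s\<close>. Hence \<open>K' * (g - g s)\<close> is nonnegative throughout and the
  integral of \<open>K' * g\<close> is at least \<open>g s * (K x - K a)\<close>, which is nonnegative
  (\<open>integral_derivative_mult_antimono_nonneg\<close>, \<open>integral_left_of_support\<close>). Formally this replaces an
  integration by parts against the derivative of \<open>f\<close>.
\<close>

section \<open>One-sided derivatives of a convex function\<close>

text \<open>
  The slopes from \<open>x\<close> to points on its right increase with the point, so they converge to their
  infimum as the point tends to \<open>x\<close>. That the right derivative is this infimum is also what puts
  the graph above the right tangent.
\<close>

lemma convex_right_derivative:
  fixes f :: "real \<Rightarrow> real"
  assumes f: "convex_on {a..b} f" and x: "a < x" "x < b"
  shows "(f has_real_derivative right_deriv f x) (at_right x)" (is ?deriv)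
    and "\<And>t. x \<le> t \<Longrightarrow> t \<le> b \<Longrightarrow> f x + right_deriv f x * (t - x) \<le> f t"
proof -
  define \<phi> where "\<phi> t = (f t - f x) / (t - x)" for t
  define D where "D = Inf (\<phi> ` {x<..b})"
  have mono: "\<phi> s \<le> \<phi> t" if "x < s" "s \<le> t" "t \<le> b" for s t
  proof (cases "s = t")
    case False
    then have "(f x - f s) / (x - s) \<le> (f x - f t) / (x - t)"
      using that x by (intro convex_on_slope_le(1)[OF f]) auto
    moreover have "(f x - f u) / (x - u) = \<phi> u" for u
      unfolding \<phi>_def by (metis minus_diff_eq minus_divide_divide)
    ultimately show ?thesis by simp
  qed simp
  \<comment> \<open>Slopes to the right of an interior point are bounded below by any slope to its left.\<close>
  have bdd: "bdd_below (\<phi> ` {x<..b})"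
  proof (rule bdd_belowI2)
    fix t assume t: "t \<in> {x<..b}"
    have "(f a - f x) / (a - x) \<le> (f a - f t) / (a - t)"
      using t x by (intro convex_on_slope_le(1)[OF f]) auto
    also have "\<dots> \<le> (f x - f t) / (x - t)"
      using t x by (intro convex_on_slope_le(2)[OF f]) auto
    also have "\<dots> = \<phi> t"
      unfolding \<phi>_def by (metis minus_diff_eq minus_divide_divide)
    finally show "(f a - f x) / (a - x) \<le> \<phi> t" .
  qed
  have D_le: "D \<le> \<phi> t" if "x < t" "t \<le> b" for t
    unfolding D_def using that by (intro cINF_lower bdd) auto
  have "(\<phi> \<longlongrightarrow> D) (at_right x)"
  proof (rule order_tendstoI)
    fix l assume "l < D"
    show "eventually (\<lambda>t. l < \<phi> t) (at_right x)"
      using eventually_at_right_real[OF \<open>x < b\<close>]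
    proof eventually_elim
      case (elim t)
      then show ?case using D_le[of t] \<open>l < D\<close> by auto
    qed
  next
    fix u assume "D < u"
    then obtain s where s: "s \<in> {x<..b}" "\<phi> s < u"
      unfolding D_def using cInf_lessD[of "\<phi> ` {x<..b}" u] x by auto
    have "x < s" using s by simp
    from eventually_at_right_real[OF this] show "eventually (\<lambda>t. \<phi> t < u) (at_right x)"
    proof eventually_elim
      case (elim t)
      then show ?case using mono[of t s] s by auto
    qed
  qed
  then have der: "(f has_real_derivative D) (at_right x)"
    by (simp add: has_field_derivative_iff \<phi>_def[abs_def])
  have eq: "right_deriv f x = D"
    unfolding right_deriv_def
  proof (rule the_equality)
    show "(f has_real_derivative D) (at_right x)" by (rule der)
    fix E assume "(f has_real_derivative E) (at_right x)"
    with der show "E = D"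
      by (auto simp: has_field_derivative_iff intro: tendsto_unique[rotated])
  qed
  show ?deriv using der eq by simp
  show "f x + right_deriv f x * (t - x) \<le> f t" if "x \<le> t" "t \<le> b" for t
  proof (cases "t = x")
    case False
    then show ?thesis
      using D_le[of t] that eq by (simp add: \<phi>_def field_simps)
  qed simp
qed

text \<open>Reflection at the origin reduces the left tangent to the right one.\<close>

lemma convex_left_support:
  fixes f :: "real \<Rightarrow> real"
  assumes f: "convex_on {a..b} f" and x: "a < x" "x < b" and t: "a \<le> t" "t \<le> x"
  shows "f x + left_deriv f x * (t - x) \<le> f t"
proof -
  define g where "g = (\<lambda>t. f (- t))"
  have g: "convex_on {-b..-a} g"
  proof (rule convex_onI)
    fix s u v :: real
    assume s: "0 < s" "s < 1" and uv: "u \<in> {-b..-a}" "v \<in> {-b..-a}"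
    have "f ((1 - s) *\<^sub>R (-u) + s *\<^sub>R (-v)) \<le> (1 - s) * f (-u) + s * f (-v)"
      using s uv by (intro convex_onD[OF f]) auto
    then show "g ((1 - s) *\<^sub>R u + s *\<^sub>R v) \<le> (1 - s) * g u + s * g v"
      by (simp add: g_def algebra_simps)
  qed simp
  note R = convex_right_derivative[OF g, of "-x"]
  have quot: "(g (-y) - g (-x)) / (-y - (-x)) = - ((f y - f x) / (y - x))" for y
    unfolding g_def by simp (metis minus_diff_eq divide_minus_right)
  have iff: "(f has_real_derivative E) (at_left x) \<longleftrightarrow> (g has_real_derivative - E) (at_right (-x))"
    for E
    using quot[of "- y" for y]
    by (simp add: has_field_derivative_iff filterlim_at_left_to_right tendsto_minus_cancel_left)
  have "left_deriv f x = - right_deriv g (-x)"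
    unfolding left_deriv_def
  proof (rule the_equality)
    show "(f has_real_derivative - right_deriv g (- x)) (at_left x)"
      using R(1) x by (simp add: iff)
    fix E assume "(f has_real_derivative E) (at_left x)"
    then have "(g has_real_derivative - E) (at_right (-x))" by (simp add: iff)
    moreover have "(g has_real_derivative right_deriv g (-x)) (at_right (-x))"
      using R(1) x by simp
    ultimately have "- E = right_deriv g (-x)"
      by (auto simp: has_field_derivative_iff intro: tendsto_unique[rotated])
    then show "E = - right_deriv g (- x)" by simp
  qed
  then show ?thesis
    using R(2)[of "-t"] x t by (simp add: g_def algebra_simps)
qed

section \<open>Integrating a convex function against a weight\<close>

text \<open>
  Weight and function are required to be continuous only in the interior: a convex function may
  jump at the ends of its interval, and the weight \<open>(b - t) powr 0\<close> does so at \<open>t = b\<close>, because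
  \<open>0 powr 0 = 0\<close>.
\<close>

lemma convex_mult_integrable:
  fixes f h :: "real \<Rightarrow> real"
  assumes f: "convex_on {a..b} f"
    and h: "continuous_on {a<..<b} h" "\<And>t. t \<in> {a<..<b} \<Longrightarrow> \<bar>h t\<bar> \<le> C"
  shows "(\<lambda>t. h t * f t) integrable_on {a..b}"
proof -
  define M where "M = max (f a) (f b)"
  define B where "B = \<bar>M\<bar> + 2 * \<bar>f ((a + b) / 2)\<bar>"
  have fB: "\<bar>f t\<bar> \<le> B" if "t \<in> {a..b}" for t
  proof -
    have up: "f s \<le> M" if "s \<in> {a..b}" for s
      unfolding M_def using convex_on_le_max[OF f that] .
    \<comment> \<open>Reflection in the midpoint turns the upper bound into a lower one.\<close>
    have "f ((1 - 1/2) *\<^sub>R t + (1/2) *\<^sub>R (a + b - t)) \<le> (1 - 1/2) * f t + (1/2) * f (a + b - t)"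
      using that by (intro convex_onD[OF f]) auto
    then have "2 * f ((a + b) / 2) \<le> f t + f (a + b - t)"
      by (simp add: field_simps)
    with up[of t] up[of "a + b - t"] that show ?thesis
      unfolding B_def by auto
  qed
  have "continuous_on {a<..<b} f"
    by (rule convex_on_continuous) (auto intro: convex_on_subset[OF f])
  then have meas: "(\<lambda>t. h t * f t) \<in> borel_measurable (lebesgue_on {a<..<b})"
    using h(1) by (intro continuous_imp_measurable_on_sets_lebesgue continuous_on_mult) auto
  have bound: "\<bar>h t * f t\<bar> \<le> \<bar>C\<bar> * B" if "t \<in> {a<..<b}" for t
    using h(2)[OF that] fB[of t] that unfolding abs_mult by (intro mult_mono) auto
  have const: "(\<lambda>t. \<bar>C\<bar> * B) integrable_on {a<..<b}"
    unfolding integrable_on_Icc_iff_Ioo[symmetric] by (rule integrable_const_ivl)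
  have "(\<lambda>t. h t * f t) integrable_on {a<..<b}"
    by (rule measurable_bounded_by_integrable_imp_integrable_real[OF meas const bound]) simp_all
  then show ?thesis
    by (simp add: integrable_on_Icc_iff_Ioo)
qed

text \<open>
  A weight that is first nonnegative and then nonpositive puts its positive mass where a
  decreasing function is large: \<open>k * (g - g s)\<close> is nonnegative on either side of the sign change \<open>s\<close>,
  so \<open>g\<close> may be replaced by the constant \<open>g s\<close>.
\<close>

lemma integral_derivative_mult_antimono_nonneg:
  fixes K k g :: "real \<Rightarrow> real"
  assumes s: "s \<in> {a..x}"
    and K: "(k has_integral K x - K a) {a..x}" "K a \<le> K x"
    and sign: "\<And>t. t \<in> {a..x} \<Longrightarrow> t \<le> s \<Longrightarrow> 0 \<le> k t" "\<And>t. t \<in> {a..x} \<Longrightarrow> s < t \<Longrightarrow> k t \<le> 0"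
    and g: "antimono_on {a..x} g" "0 \<le> g s"
    and kg: "(\<lambda>t. k t * g t) integrable_on {a..x}"
  shows "0 \<le> integral {a..x} (\<lambda>t. k t * g t)"
proof -
  have "k t * g s \<le> k t * g t" if t: "t \<in> {a..x}" for t
  proof (cases "t \<le> s")
    case True
    then have "g s \<le> g t" using g(1) s t by (auto simp: monotone_on_def)
    then show ?thesis using sign(1)[OF t True] by (rule mult_left_mono)
  next
    case False
    then have "g t \<le> g s" using g(1) s t by (auto simp: monotone_on_def)
    then show ?thesis using sign(2)[OF t] False by (intro mult_left_mono_neg) auto
  qed
  then have "(K x - K a) * g s \<le> integral {a..x} (\<lambda>t. k t * g t)"
    using has_integral_mult_left[OF K(1)] kg
    by (intro has_integral_le[OF _ integrable_integral]) auto
  moreover have "0 \<le> (K x - K a) * g s" using K(2) g(2) by simp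
  ultimately show ?thesis by linarith
qed

lemma continuous_on_powr_diff:
  fixes b r x :: real
  assumes "x < b"
  shows "continuous_on {a..x} (\<lambda>t. (b - t) powr r)"
  using assms by (intro continuous_on_powr continuous_intros) auto

lemma has_derivative_powr_diff:
  fixes b r t :: real
  assumes "t < b"
  shows "((\<lambda>t. (b - t) powr r) has_real_derivative - (r * (b - t) powr (r - 1))) (at t)"
  using assms by (auto intro!: derivative_eq_intros simp: powr_diff)

lemma powr_diff_mult_convex_integrable:
  fixes b r :: real
  assumes f: "convex_on {a..b} f" and r: "0 \<le> r"
  shows "(\<lambda>t. (b - t) powr r * f t) integrable_on {a..b}"
proof (rule convex_mult_integrable[OF f])
  show "continuous_on {a<..<b} (\<lambda>t. (b - t) powr r)"
    by (intro continuous_on_powr continuous_intros) auto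
  show "\<bar>(b - t) powr r\<bar> \<le> (b - a) powr r" if "t \<in> {a<..<b}" for t
    using that r by (auto intro!: powr_mono2)
qed

lemma continuous_mult_convex_integrable:
  fixes f h :: "real \<Rightarrow> real"
  assumes f: "convex_on {a..b} f" and h: "continuous_on {a..b} h"
  shows "(\<lambda>t. h t * f t) integrable_on {a..b}"
proof -
  have "bounded (h ` {a..b})"
    by (intro compact_imp_bounded compact_continuous_image h) simp
  then obtain C where "\<forall>t\<in>{a..b}. \<bar>h t\<bar> \<le> C"
    by (auto simp: bounded_iff)
  then show ?thesis
    by (intro convex_mult_integrable[OF f] continuous_on_subset[OF h]) auto
qed

section \<open>The contribution of each side of the point\<close>

text \<open>
  The lower bound is the value of the integral for the affine function with slope \<open>p\<close> through
  \<open>(x, f x)\<close>.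
\<close>

lemma integral_right_of_support:
  fixes f :: "real \<Rightarrow> real"
  assumes f: "convex_on {x..b} f" and "x < b" and \<alpha>: "1 \<le> \<alpha>"
    and supp: "\<And>t. x \<le> t \<Longrightarrow> t \<le> b \<Longrightarrow> f x + p * (t - x) \<le> f t"
  shows "f x * (b - x) powr \<alpha> + p * (b - x) powr (\<alpha> + 1) / (\<alpha> + 1)
           \<le> \<alpha> * integral {x..b} (\<lambda>t. (b - t) powr (\<alpha> - 1) * f t)"
proof -
  define B where "B = p / (\<alpha> + 1)"
  have p: "p = B * (\<alpha> + 1)" using \<alpha> by (simp add: B_def)
  \<comment> \<open>An antiderivative of the weight times the affine minorant, found by integration by parts.\<close>
  define F where "F t = - ((b - t) powr \<alpha> * (f x + p * (t - x))) - B * (b - t) powr (\<alpha> + 1)" for t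
  have "((\<lambda>t. \<alpha> * ((b - t) powr (\<alpha> - 1) * (f x + p * (t - x)))) has_integral F b - F x) {x..b}"
  proof (rule fundamental_theorem_of_calculus_interior)
    show "continuous_on {x..b} F"
      unfolding F_def using \<alpha> by (intro continuous_intros continuous_on_powr') auto
    show "(F has_vector_derivative \<alpha> * ((b - t) powr (\<alpha> - 1) * (f x + p * (t - x)))) (at t)"
      if "t \<in> {x<..<b}" for t
      unfolding has_real_derivative_iff_has_vector_derivative[symmetric] F_def
      using that \<alpha>
      by (auto intro!: derivative_eq_intros has_derivative_powr_diff simp: p algebra_simps)
  qed (use \<open>x < b\<close> in simp)
  moreover have "((\<lambda>t. \<alpha> * ((b - t) powr (\<alpha> - 1) * f t)) has_integral
      \<alpha> * integral {x..b} (\<lambda>t. (b - t) powr (\<alpha> - 1) * f t)) {x..b}"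
    using \<alpha> by (intro has_integral_mult_right integrable_integral powr_diff_mult_convex_integrable f) auto
  ultimately have "F b - F x \<le> \<alpha> * integral {x..b} (\<lambda>t. (b - t) powr (\<alpha> - 1) * f t)"
    by (rule has_integral_le) (use supp \<alpha> in \<open>auto intro!: mult_left_mono\<close>)
  then show ?thesis
    using \<alpha> by (simp add: F_def B_def algebra_simps)
qed

text \<open>
  This is the derivative of \<open>(t - a) * (b - t) powr (\<alpha> - 1)\<close>, kept in the unfactored form in which it
  arises from the two fractional integrals.
\<close>

definition left_kernel :: "real \<Rightarrow> real \<Rightarrow> real \<Rightarrow> real \<Rightarrow> real" where
  "left_kernel a b \<alpha> t = (b - t) powr (\<alpha> - 1) - (\<alpha> - 1) * ((b - t) powr (\<alpha> - 2) * (t - a))"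

text \<open>
  For positive \<open>\<alpha>\<close> the affine factor shows that the kernel changes sign at most once, from positive
  to negative.
\<close>

lemma left_kernel_factor:
  assumes "t < b"
  shows "left_kernel a b \<alpha> t = (b - t) powr (\<alpha> - 2) * (b + (\<alpha> - 1) * a - \<alpha> * t)"
proof -
  have "(b - t) powr (\<alpha> - 1) = (b - t) powr (\<alpha> - 2) * (b - t)"
    using powr_mult_base[of "b - t" "\<alpha> - 2"] assms by (simp add: mult.commute)
  then show ?thesis
    by (simp add: left_kernel_def algebra_simps)
qed

lemma continuous_on_left_kernel:
  assumes "x < b"
  shows "continuous_on {a..x} (left_kernel a b \<alpha>)"
  unfolding left_kernel_def[abs_def]
  using assms by (intro continuous_intros continuous_on_powr_diff)

lemma left_kernel_antiderivative:
  assumes "t < b"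
  shows "((\<lambda>t. (t - a) * (b - t) powr (\<alpha> - 1)) has_real_derivative left_kernel a b \<alpha> t) (at t)"
  unfolding left_kernel_def using assms
  by (auto intro!: derivative_eq_intros has_derivative_powr_diff simp: algebra_simps)

text \<open>
  Again the lower bound is the value for the affine minorant, here of slope \<open>m\<close>. Since the kernel
  may be negative near \<open>x\<close>, the comparison needs that the gap between \<open>f\<close> and the minorant
  decreases on \<open>[a, x]\<close>.
\<close>

lemma integral_left_of_support:
  fixes f :: "real \<Rightarrow> real"
  assumes f: "convex_on {a..x} f" and "a < x" "x < b" and \<alpha>: "1 \<le> \<alpha>"
    and supp: "\<And>t. a \<le> t \<Longrightarrow> t \<le> x \<Longrightarrow> f x + m * (t - x) \<le> f t"
  shows "f x * ((x - a) * (b - x) powr (\<alpha> - 1))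
           - m * ((b - a) powr (\<alpha> + 1) / (\<alpha> * (\<alpha> + 1)) - (b - a) * (b - x) powr \<alpha> / \<alpha>
                  + (b - x) powr (\<alpha> + 1) / (\<alpha> + 1))
         \<le> integral {a..x} (\<lambda>t. left_kernel a b \<alpha> t * f t)"
proof -
  define k where "k = left_kernel a b \<alpha>"
  define K where "K t = (t - a) * (b - t) powr (\<alpha> - 1)" for t
  \<comment> \<open>An antiderivative of \<open>K\<close>, from the decomposition \<open>t - a = (b - a) - (b - t)\<close>.\<close>
  define G where "G t = (b - t) powr (\<alpha> + 1) / (\<alpha> + 1) - (b - a) * (b - t) powr \<alpha> / \<alpha>" for t
  define g where "g t = f t - (f x + m * (t - x))" for t
  \<comment> \<open>The zero of \<open>k\<close>, or \<open>x\<close> if \<open>k\<close> does not change sign before \<open>x\<close>.\<close>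
  define s where "s = min x ((b + (\<alpha> - 1) * a) / \<alpha>)"
  have K: "(K has_real_derivative k t) (at t)" if "t < b" for t
    unfolding K_def k_def using left_kernel_antiderivative[OF that] .
  have G: "(G has_real_derivative K t) (at t)" if "t < b" for t
  proof -
    have "(G has_real_derivative (b - a) * (b - t) powr (\<alpha> - 1) - (b - t) powr \<alpha>) (at t)"
    proof -
      have "((\<lambda>t. (b - t) powr r / r) has_real_derivative - ((b - t) powr (r - 1))) (at t)"
        if "r \<noteq> 0" for r
        using DERIV_cdivide[OF has_derivative_powr_diff[OF \<open>t < b\<close>], of r r] that by simp
      from DERIV_diff[OF this[of "\<alpha> + 1"] DERIV_cmult[OF this[of \<alpha>], of "b - a"]]
      show ?thesis using \<alpha> by (simp add: G_def[abs_def])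
    qed
    moreover have "(b - t) powr \<alpha> = (b - t) * (b - t) powr (\<alpha> - 1)"
      using powr_mult_base[of "b - t" "\<alpha> - 1"] that by simp
    ultimately show ?thesis by (simp add: K_def algebra_simps)
  qed
  have intk: "(k has_integral K x - K a) {a..x}"
    using assms
    by (intro fundamental_theorem_of_calculus)
       (auto simp: has_real_derivative_iff_has_vector_derivative[symmetric]
             intro!: has_field_derivative_at_within K)
  have lin: "((\<lambda>t. k t * (f x + m * (t - x))) has_integral
      (K x * f x - m * G x) - (K a * (f x + m * (a - x)) - m * G a)) {a..x}"
  proof -
    define F where "F t = K t * (f x + m * (t - x)) - m * G t" for t
    have F: "(F has_real_derivative k t * (f x + m * (t - x))) (at t)" if "t < b" for t
      unfolding F_def using that by (auto intro!: derivative_eq_intros K G simp: algebra_simps)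
    have "((\<lambda>t. k t * (f x + m * (t - x))) has_integral F x - F a) {a..x}"
      using assms
      by (intro fundamental_theorem_of_calculus)
         (auto simp: has_real_derivative_iff_has_vector_derivative[symmetric]
               intro!: has_field_derivative_at_within F)
    then show ?thesis by (simp add: F_def)
  qed
  have kf: "((\<lambda>t. k t * f t) has_integral integral {a..x} (\<lambda>t. k t * f t)) {a..x}"
    unfolding k_def using \<open>x < b\<close>
    by (intro integrable_integral continuous_mult_convex_integrable[OF f] continuous_on_left_kernel)
  have kg: "((\<lambda>t. k t * g t) has_integral integral {a..x} (\<lambda>t. k t * f t) -
      ((K x * f x - m * G x) - (K a * (f x + m * (a - x)) - m * G a))) {a..x}"
    using has_integral_diff[OF kf lin] by (simp add: g_def algebra_simps)
  have "0 \<le> integral {a..x} (\<lambda>t. k t * g t)"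
  proof (rule integral_derivative_mult_antimono_nonneg[where s = s and K = K])
    have "a * \<alpha> \<le> b + (\<alpha> - 1) * a"
      using assms by (simp add: algebra_simps)
    then have "a \<le> (b + (\<alpha> - 1) * a) / \<alpha>"
      using \<alpha> by (simp add: pos_le_divide_eq)
    then show s: "s \<in> {a..x}"
      using \<open>a < x\<close> by (auto simp: s_def)
    show "K a \<le> K x" using assms by (simp add: K_def)
    show "0 \<le> k t" if "t \<in> {a..x}" "t \<le> s" for t
    proof -
      have "t \<le> (b + (\<alpha> - 1) * a) / \<alpha>" using that by (simp add: s_def)
      then have "\<alpha> * t \<le> b + (\<alpha> - 1) * a"
        using \<alpha> by (simp add: pos_le_divide_eq mult.commute)
      then show ?thesis
        using that \<open>x < b\<close> by (simp add: k_def left_kernel_factor)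
    qed
    show "k t \<le> 0" if "t \<in> {a..x}" "s < t" for t
    proof -
      have "(b + (\<alpha> - 1) * a) / \<alpha> \<le> t"
        using that by (auto simp: s_def)
      then have "b + (\<alpha> - 1) * a \<le> \<alpha> * t"
        using \<alpha> by (simp add: pos_divide_le_eq mult.commute)
      then show ?thesis
        using that \<open>x < b\<close> by (simp add: k_def left_kernel_factor mult_nonneg_nonpos)
    qed
    \<comment> \<open>The slope of \<open>f\<close> over \<open>[u, v]\<close> is at most that over \<open>[v, x]\<close>, hence at most \<open>m\<close>.\<close>
    show "antimono_on {a..x} g"
    proof (rule monotone_onI)
      fix u v assume uv: "u \<in> {a..x}" "v \<in> {a..x}" "u \<le> v"
      show "g v \<le> g u"
      proof (cases "u = v \<or> v = x")
        case True
        then show ?thesis using supp[of u] uv by (auto simp: g_def)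
      next
        case False
        then have lt: "u < v" "v < x" using uv by auto
        have "(f u - f v) / (u - v) \<le> (f u - f x) / (u - x)"
          using uv lt by (intro convex_on_slope_le(1)[OF f]) auto
        also have "\<dots> \<le> (f v - f x) / (v - x)"
          using uv lt by (intro convex_on_slope_le(2)[OF f]) auto
        also have "\<dots> \<le> m"
          using supp[of v] uv lt by (simp add: divide_le_eq algebra_simps)
        finally show ?thesis
          using lt by (simp add: g_def divide_le_eq algebra_simps)
      qed
    qed
    show "0 \<le> g s" using supp[of s] s by (simp add: g_def)
    show "(\<lambda>t. k t * g t) integrable_on {a..x}" using kg by blast
  qed (rule intk)
  moreover have "K a = 0" by (simp add: K_def)
  ultimately have "K x * f x - m * (G x - G a) \<le> integral {a..x} (\<lambda>t. k t * f t)"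
    using kg by (simp add: integral_unique algebra_simps)
  moreover have "G a = - ((b - a) powr (\<alpha> + 1) / (\<alpha> * (\<alpha> + 1)))"
  proof -
    have "(b - a) powr (\<alpha> + 1) = (b - a) * (b - a) powr \<alpha>"
      using powr_mult_base[of "b - a" \<alpha>] assms by (simp add: add.commute)
    then show ?thesis using \<alpha> by (simp add: G_def divide_simps) (simp add: algebra_simps)
  qed
  ultimately have "K x * f x - m * (G x + (b - a) powr (\<alpha> + 1) / (\<alpha> * (\<alpha> + 1)))
      \<le> integral {a..x} (\<lambda>t. k t * f t)"
    by simp
  then show ?thesis
    by (simp add: k_def K_def G_def algebra_simps)
qed

section \<open>The fractional integrals\<close>

text \<open>
  The branch of \<open>P2\<close> to the right of \<open>x\<close> restores the missing factor \<open>b - t\<close>, so both fractional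
  integrals carry the weight \<open>(b - t) powr (\<alpha> - 1)\<close> there and merge into one; on the left they
  supply the two terms of \<open>left_kernel\<close>.
\<close>

lemma rl_integral_difference_eq:
  fixes f :: "real \<Rightarrow> real"
  assumes f: "convex_on {a..b} f" and x: "a < x" "x < b" and \<alpha>: "1 \<le> \<alpha>"
  shows "Gamma \<alpha> / (b - a) * (b - x) powr (1 - \<alpha>) * rl_integral a \<alpha> f b
           - rl_integral a (\<alpha> - 1) (\<lambda>t. P2 a b \<alpha> x t * f t) b
         = (b - x) powr (1 - \<alpha>) / (b - a) *
             (integral {a..x} (\<lambda>t. left_kernel a b \<alpha> t * f t)
              + \<alpha> * integral {x..b} (\<lambda>t. (b - t) powr (\<alpha> - 1) * f t))"
proof -
  define c where "c = (b - x) powr (1 - \<alpha>) / (b - a)"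
  define w where "w t = (b - t) powr (\<alpha> - 1) * f t" for t
  define v where "v t = (b - t) powr (\<alpha> - 2) * (t - a) * f t" for t
  have fx: "convex_on {a..x} f" "convex_on {x..b} f"
    using x by (auto intro: convex_on_subset[OF f])
  have w1: "(w has_integral integral {a..x} w) {a..x}"
    unfolding w_def using x
    by (intro integrable_integral continuous_mult_convex_integrable fx continuous_on_powr_diff)
  have w2: "(w has_integral integral {x..b} w) {x..b}"
    unfolding w_def using \<alpha> by (intro integrable_integral powr_diff_mult_convex_integrable fx) auto
  have v: "(v has_integral integral {a..x} v) {a..x}"
    unfolding v_def using x
    by (intro integrable_integral continuous_mult_convex_integrable fx continuous_intros
        continuous_on_powr_diff)
  have "((\<lambda>t. left_kernel a b \<alpha> t * f t) has_integral
      integral {a..x} w - (\<alpha> - 1) * integral {a..x} v) {a..x}"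
    using has_integral_diff[OF w1 has_integral_mult_right[OF v, of "\<alpha> - 1"]]
    by (simp add: w_def v_def left_kernel_def algebra_simps)
  then have left: "integral {a..x} (\<lambda>t. left_kernel a b \<alpha> t * f t) =
      integral {a..x} w - (\<alpha> - 1) * integral {a..x} v"
    by (rule integral_unique)
  have "integral {a..b} w = integral {a..x} w + integral {x..b} w"
    using has_integral_combine[OF _ _ w1 w2] x by (simp add: integral_unique)
  then have J1: "Gamma \<alpha> / (b - a) * (b - x) powr (1 - \<alpha>) * rl_integral a \<alpha> f b =
      c * (integral {a..x} w + integral {x..b} w)"
    using \<alpha> less_imp_neq[OF Gamma_real_pos, of \<alpha>]
    by (simp add: rl_integral_def c_def w_def[symmetric])
  have J2: "rl_integral a (\<alpha> - 1) (\<lambda>t. P2 a b \<alpha> x t * f t) b =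
      c * (\<alpha> - 1) * (integral {a..x} v - integral {x..b} w)"
  proof (cases "\<alpha> = 1")
    case True
    \<comment> \<open>The integral of order \<open>0\<close> is evaluation at \<open>b\<close>, where \<open>P2\<close> vanishes.\<close>
    then show ?thesis using x by (simp add: rl_integral_def P2_def)
  next
    case False
    define q where "q t = (b - t) powr (\<alpha> - 2) * (P2 a b \<alpha> x t * f t)" for t
    \<comment> \<open>At \<open>t = x\<close> the kernel already takes the value of its right branch.\<close>
    have "(q has_integral c * Gamma \<alpha> * integral {a..x} v) {a..x}"
    proof (rule has_integral_spike_finite[OF _ _ has_integral_mult_right[OF v]])
      show "q t = c * Gamma \<alpha> * v t" if "t \<in> {a..x} - {x}" for t
        using that by (simp add: q_def v_def c_def P2_def)
    qed simp
    moreover have "(q has_integral - (c * Gamma \<alpha>) * integral {x..b} w) {x..b}"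
    proof (rule has_integral_eq[OF _ has_integral_mult_right[OF w2]])
      show "- (c * Gamma \<alpha>) * w t = q t" if "t \<in> {x..b}" for t
      proof -
        have "(b - t) powr (\<alpha> - 1) = (b - t) * (b - t) powr (\<alpha> - 2)"
          using powr_mult_base[of "b - t" "\<alpha> - 2"] that by simp
        moreover have "P2 a b \<alpha> x t = - (c * Gamma \<alpha>) * (b - t)"
          using that by (simp add: P2_def c_def diff_divide_distrib algebra_simps)
        ultimately show ?thesis by (simp add: q_def w_def)
      qed
    qed
    ultimately have "(q has_integral c * Gamma \<alpha> * integral {a..x} v
        + - (c * Gamma \<alpha>) * integral {x..b} w) {a..b}"
      using x by (intro has_integral_combine) auto
    then have "integral {a..b} q = c * Gamma \<alpha> * (integral {a..x} v - integral {x..b} w)"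
      by (simp add: integral_unique algebra_simps)
    moreover have "Gamma \<alpha> = (\<alpha> - 1) * Gamma (\<alpha> - 1)"
      using Gamma_plus1[of "\<alpha> - 1"] nonpos_Ints_nonpos[of "\<alpha> - 1"] False \<alpha> by fastforce
    moreover have "Gamma (\<alpha> - 1) > 0"
      using False \<alpha> by (intro Gamma_real_pos) auto
    ultimately show ?thesis
      using False by (simp add: rl_integral_def q_def[symmetric])
  qed
  show ?thesis
    unfolding J1 J2 left w_def[symmetric] c_def[symmetric] by (simp add: algebra_simps)
qed

section \<open>The inequality\<close>

theorem theorem1:
  fixes a b x \<alpha> :: real and f :: "real \<Rightarrow> real"
  assumes "0 \<le> a" and "a < b"
    and "convex_on {a..b} f"
    and "x \<in> {a<..<b}"
    and "1 \<le> \<alpha>"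
  shows "1 / (\<alpha> * (\<alpha> + 1)) *
           (\<alpha> * ((b - x)\<^sup>2 / (b - a)) * right_deriv f x
            - ((b - a) powr \<alpha> * (b - x) powr (1 - \<alpha>)
               + \<alpha> * ((b - x)\<^sup>2 / (b - a))
               - (\<alpha> + 1) * (b - x)) * left_deriv f x)
         \<le> Gamma \<alpha> / (b - a) * (b - x) powr (1 - \<alpha>) * rl_integral a \<alpha> f b
           - rl_integral a (\<alpha> - 1) (\<lambda>t. P2 a b \<alpha> x t * f t) b
           - f x"
proof -
  have f: "convex_on {a..b} f" and x: "a < x" "x < b" and \<alpha>: "1 \<le> \<alpha>"
    using assms by auto
  define p where "p = right_deriv f x"
  define m where "m = left_deriv f x"
  define c where "c = (b - x) powr (1 - \<alpha>)"
  define h where "h = b - x"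
  define L where "L = b - a"
  define A where "A = (b - a) powr \<alpha>"
  define U where "U = (b - x) powr (\<alpha> - 1)"
  define I where "I = integral {a..x} (\<lambda>t. left_kernel a b \<alpha> t * f t)"
  define J where "J = \<alpha> * integral {x..b} (\<lambda>t. (b - t) powr (\<alpha> - 1) * f t)"
  have pos: "0 < h" "0 < L" "0 < c" using x by (auto simp: h_def L_def c_def)
  have cU: "c * U = 1"
    using x by (simp add: c_def U_def flip: powr_add)
  have pw: "(b - x) powr \<alpha> = h * U" "(b - a) powr (\<alpha> + 1) = L * A"
    using powr_mult_base[of "b - x" "\<alpha> - 1"] powr_mult_base[of "b - a" \<alpha>] x
    by (auto simp: h_def L_def A_def U_def add.commute)
  have pw2: "(b - x) powr (\<alpha> + 1) = h\<^sup>2 * U"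
    using powr_mult_base[of "b - x" \<alpha>] x pw(1)
    by (simp add: h_def power2_eq_square add.commute)
  have "f x * (h * U) + p * (h\<^sup>2 * U) / (\<alpha> + 1) \<le> J"
    using integral_right_of_support[of x b f \<alpha> p] convex_right_derivative(2)[OF f x] x \<alpha>
      convex_on_subset[OF f, of "{x..b}"]
    by (simp add: J_def pw pw2 p_def)
  moreover have "f x * ((L - h) * U) - m * (L * A / (\<alpha> * (\<alpha> + 1)) - L * (h * U) / \<alpha> + h\<^sup>2 * U / (\<alpha> + 1)) \<le> I"
    using integral_left_of_support[of a x f b \<alpha> m] convex_left_support[OF f x] x \<alpha>
      convex_on_subset[OF f, of "{a..x}"]
    by (simp add: I_def pw pw2 m_def U_def[symmetric]) (simp add: h_def L_def)
  ultimately have "f x * (L * U) + p * (h\<^sup>2 * U) / (\<alpha> + 1)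
      - m * (L * A / (\<alpha> * (\<alpha> + 1)) - L * (h * U) / \<alpha> + h\<^sup>2 * U / (\<alpha> + 1)) \<le> I + J"
    by (simp add: algebra_simps)
  then have "c / L * (f x * (L * U) + p * (h\<^sup>2 * U) / (\<alpha> + 1)
      - m * (L * A / (\<alpha> * (\<alpha> + 1)) - L * (h * U) / \<alpha> + h\<^sup>2 * U / (\<alpha> + 1))) \<le> c / L * (I + J)"
    using pos by (intro mult_left_mono) auto
  also have "c / L * (f x * (L * U) + p * (h\<^sup>2 * U) / (\<alpha> + 1)
      - m * (L * A / (\<alpha> * (\<alpha> + 1)) - L * (h * U) / \<alpha> + h\<^sup>2 * U / (\<alpha> + 1))) =
      1 / L * (f x * (L * (c * U)) + p * (h\<^sup>2 * (c * U)) / (\<alpha> + 1)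
      - m * (L * (A * c) / (\<alpha> * (\<alpha> + 1)) - L * (h * (c * U)) / \<alpha> + h\<^sup>2 * (c * U) / (\<alpha> + 1)))"
    by (simp add: algebra_simps)
  also have "\<dots> = f x + 1 / (\<alpha> * (\<alpha> + 1)) *
      (\<alpha> * (h\<^sup>2 / L) * p - (A * c + \<alpha> * (h\<^sup>2 / L) - (\<alpha> + 1) * h) * m)"
    unfolding cU using pos \<alpha> by (simp add: divide_simps) (simp add: algebra_simps)
  finally show ?thesis
    unfolding rl_integral_difference_eq[OF f x \<alpha>]
    unfolding p_def[symmetric] m_def[symmetric] c_def[symmetric] A_def[symmetric]
      I_def[symmetric] J_def[symmetric]
    unfolding h_def[symmetric] L_def[symmetric]
    by simp
qed

end
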